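(* Let $E$ be a complete separable metric space and let $m$ be a $\sigma$-finite Borel measure on $E$ with full support. Let $(T(t))_{t>0}$ be an injective and contractive $*$-semigroup on $L^\infty(E,m)$ with generator $A$, and assume that every operator $T(t)$, $t>0$, is a positive strong Feller operator. Then the following hold. (a) If $(t_n)\subset(0,\infty)$ converges to $t>0$ and $f\in L^\infty(E,m)$, then $T(t_n)f\to T(t)f$ locally uniformly, i.e. uniformly on compact subsets of $E$. (b) For every $f\in L^\infty(E,m)$ the map $(0,\infty)\times E\ni(t,x)\mapsto(T(t)f)(x)$ is continuous.
   Context: $m$ has full support if $m(B_r(x))>0$ for every $x\in E$, $r>0$. $L^\infty(E,m)$ is regarded as the dual of the separable space $L^1(E,m)$. A $*$-semigroup on the dual $X^*$ of a separable Banach space $X$ is a family $T=(T(t))_{t>0}$ of weak$^*$-continuous linear operators on $X^*$ with $T(t+s)=T(t)T(s)$ for all $t,s>0$ such that $t\mapsto\langle T(t)x^*,x\rangle$ is measurable for all $x^*\in X^*$, $x\in X$. It is contractive if $\|T(t)\|\le1$ for all $t>0$, and injective if $T(t)x^*=0$ for all $t>0$ implies $x^*=0$. The generator of a contractive injective $*$-semigroup is the unique operator $A$ such that for all $\mathrm{Re}\,\lambda>0$ one has $\lambda\in\rho(A)$ and $\langle R(\lambda,A)x^*,x\rangle=\int_0^\infty e^{-\lambda t}\langle T(t)x^*,x\rangle\,dt$ for all $x^*\in X^*,x\in X$. A bounded operator $K$ on $L^\infty(E,m)$ is a strong Feller operator if (i) for each $f\in L^\infty(E,m)$, $Kf$ has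 a representative in $C_b(E)$ (unique because $m$ has full support; $Kf$ is identified with it, so that $(Kf)(x)$ is defined for every $x\in E$), and (ii) for every bounded sequence $(f_n)\subset L^\infty(E,m)$ converging $m$-almost everywhere to $f$, $Kf_n\to Kf$ pointwise on $E$. *)

theory Defs
  imports "HOL-Analysis.Analysis" "HOL-Probability.Essential_Supremum"
begin

text \<open>
  Elements of the complex spaces \<open>L\<^sup>\<infinity>(E,m)\<close> and \<open>L\<^sup>1(E,m)\<close> are handled through representatives,
  i.e. as functions \<open>E \<Rightarrow> \<complex>\<close>; equality in these spaces is equality \<open>m\<close>-almost everywhere.
  Accordingly an operator on \<open>L\<^sup>\<infinity>\<close> is a map on representatives that respects almost everywhere
  equality and satisfies its algebraic identities almost everywhere.
\<close>

definition Linf_norm :: "'a measure \<Rightarrow> ('a \<Rightarrow> complex) \<Rightarrow> ennreal" where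
  "Linf_norm M f = esssup M (\<lambda>x. ennreal (norm (f x)))"

definition Linf :: "'a measure \<Rightarrow> ('a \<Rightarrow> complex) set" where
  "Linf M = {f \<in> borel_measurable M. Linf_norm M f < \<infinity>}"

definition L1 :: "'a measure \<Rightarrow> ('a \<Rightarrow> complex) set" where
  "L1 M = {g. integrable M g}"

text \<open>The bilinear pairing through which \<open>L\<^sup>\<infinity>\<close> is the dual of \<open>L\<^sup>1\<close>.\<close>

definition pairing :: "'a measure \<Rightarrow> ('a \<Rightarrow> complex) \<Rightarrow> ('a \<Rightarrow> complex) \<Rightarrow> complex" where
  "pairing M f g = (LINT x|M. f x * g x)"

text \<open>
  The coarsest topology making all functionals \<open>f \<mapsto> \<langle>f, g\<rangle>\<close>, \<open>g \<in> L\<^sup>1\<close>, continuous.  On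
  representatives it is not Hausdorff: it does not separate almost everywhere equal functions, so
  that its open sets are exactly the preimages of the weak\<open>*\<close>-open sets of equivalence classes.
\<close>

definition weak_star :: "'a measure \<Rightarrow> ('a \<Rightarrow> complex) topology" where
  "weak_star M = pullback_topology (Linf M) (\<lambda>f. \<lambda>g\<in>L1 M. pairing M f g)
     (product_topology (\<lambda>_. euclidean) (L1 M))"


section \<open>Operators\<close>

definition linear_op :: "'a measure \<Rightarrow> (('a \<Rightarrow> complex) \<Rightarrow> ('a \<Rightarrow> complex)) \<Rightarrow> bool" where
  "linear_op M K \<longleftrightarrow>
     (\<forall>f\<in>Linf M. K f \<in> Linf M) \<and>
     (\<forall>f\<in>Linf M. \<forall>g\<in>Linf M. (AE x in M. f x = g x) \<longrightarrow> (AE x in M. K f x = K g x)) \<and>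
     (\<forall>f\<in>Linf M. \<forall>g\<in>Linf M. AE x in M. K (\<lambda>y. f y + g y) x = K f x + K g x) \<and>
     (\<forall>f\<in>Linf M. \<forall>c. AE x in M. K (\<lambda>y. c * f y) x = c * K f x)"

definition op_norm :: "'a measure \<Rightarrow> (('a \<Rightarrow> complex) \<Rightarrow> ('a \<Rightarrow> complex)) \<Rightarrow> ennreal" where
  "op_norm M K = (SUP f\<in>{f \<in> Linf M. Linf_norm M f \<le> 1}. Linf_norm M (K f))"

definition bounded_op :: "'a measure \<Rightarrow> (('a \<Rightarrow> complex) \<Rightarrow> ('a \<Rightarrow> complex)) \<Rightarrow> bool" where
  "bounded_op M K \<longleftrightarrow> linear_op M K \<and> op_norm M K < \<infinity>"

definition positive_op :: "'a measure \<Rightarrow> (('a \<Rightarrow> complex) \<Rightarrow> ('a \<Rightarrow> complex)) \<Rightarrow> bool" where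
  "positive_op M K \<longleftrightarrow>
     (\<forall>f\<in>Linf M. (AE x in M. f x \<in> \<real>\<^sub>\<ge>\<^sub>0) \<longrightarrow> (AE x in M. K f x \<in> \<real>\<^sub>\<ge>\<^sub>0))"


section \<open>Strong Feller operators\<close>

definition full_support :: "'a::metric_space measure \<Rightarrow> bool" where
  "full_support M \<longleftrightarrow> (\<forall>x r. 0 < r \<longrightarrow> emeasure M (ball x r) > 0)"

definition Cb_representative ::
    "'a::metric_space measure \<Rightarrow> ('a \<Rightarrow> complex) \<Rightarrow> ('a \<Rightarrow> complex) \<Rightarrow> bool" where
  "Cb_representative M f h \<longleftrightarrow> h \<in> bcontfun \<and> (AE x in M. f x = h x)"

text \<open>
  The representative of \<open>f\<close> in \<open>C\<^sub>b(E)\<close>; meaningful only if one exists and \<open>M\<close> has full support,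
  which makes it unique.
\<close>

definition Cb_rep :: "'a::metric_space measure \<Rightarrow> ('a \<Rightarrow> complex) \<Rightarrow> ('a \<Rightarrow> complex)" where
  "Cb_rep M f = (THE h. Cb_representative M f h)"

definition strong_feller ::
    "'a::metric_space measure \<Rightarrow> (('a \<Rightarrow> complex) \<Rightarrow> ('a \<Rightarrow> complex)) \<Rightarrow> bool" where
  "strong_feller M K \<longleftrightarrow>
     bounded_op M K \<and>
     (\<forall>f\<in>Linf M. \<exists>h. Cb_representative M (K f) h) \<and>
     (\<forall>F. \<forall>f\<in>Linf M.
        (\<forall>n::nat. F n \<in> Linf M) \<and> (SUP n. Linf_norm M (F n)) < \<infinity> \<and>
        (AE x in M. (\<lambda>n. F n x) \<longlonglongrightarrow> f x) \<longrightarrow>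
        (\<forall>x. (\<lambda>n. Cb_rep M (K (F n)) x) \<longlonglongrightarrow> Cb_rep M (K f) x))"


section \<open>Semigroups on \<open>L\<^sup>\<infinity>\<close> as the dual of \<open>L\<^sup>1\<close>\<close>

text \<open>Only the values \<open>T t\<close> with \<open>t > 0\<close> are constrained.\<close>

definition star_semigroup ::
    "'a measure \<Rightarrow> (real \<Rightarrow> ('a \<Rightarrow> complex) \<Rightarrow> ('a \<Rightarrow> complex)) \<Rightarrow> bool" where
  "star_semigroup M T \<longleftrightarrow>
     (\<forall>t>0. linear_op M (T t) \<and> continuous_map (weak_star M) (weak_star M) (T t)) \<and>
     (\<forall>t>0. \<forall>s>0. \<forall>f\<in>Linf M. AE x in M. T (t + s) f x = T t (T s f) x) \<and>
     (\<forall>f\<in>Linf M. \<forall>g\<in>L1 M.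
        (\<lambda>t. pairing M (T t f) g) \<in> borel_measurable (lebesgue_on {0<..}))"

definition contractive_semigroup ::
    "'a measure \<Rightarrow> (real \<Rightarrow> ('a \<Rightarrow> complex) \<Rightarrow> ('a \<Rightarrow> complex)) \<Rightarrow> bool" where
  "contractive_semigroup M T \<longleftrightarrow> (\<forall>t>0. op_norm M (T t) \<le> 1)"

definition injective_semigroup ::
    "'a measure \<Rightarrow> (real \<Rightarrow> ('a \<Rightarrow> complex) \<Rightarrow> ('a \<Rightarrow> complex)) \<Rightarrow> bool" where
  "injective_semigroup M T \<longleftrightarrow>
     (\<forall>f\<in>Linf M. (\<forall>t>0. AE x in M. T t f x = 0) \<longrightarrow> (AE x in M. f x = 0))"


section \<open>Unbounded operators, resolvents and generators\<close>

text \<open>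
  A (possibly unbounded) operator on \<open>L\<^sup>\<infinity>\<close> is given by its graph: a subspace of pairs of
  representatives which is single-valued up to almost everywhere equality.  The graph contains all
  representatives of its elements, so that equality of operators is equality of graphs.
\<close>

definition operator_graph :: "'a measure \<Rightarrow> (('a \<Rightarrow> complex) \<times> ('a \<Rightarrow> complex)) set \<Rightarrow> bool" where
  "operator_graph M A \<longleftrightarrow>
     A \<subseteq> Linf M \<times> Linf M \<and>
     ((\<lambda>_. 0), (\<lambda>_. 0)) \<in> A \<and>
     (\<forall>f u g v. (f, u) \<in> A \<and> (g, v) \<in> A \<longrightarrow> ((\<lambda>x. f x + g x), (\<lambda>x. u x + v x)) \<in> A) \<and>
     (\<forall>f u c. (f, u) \<in> A \<longrightarrow> ((\<lambda>x. c * f x), (\<lambda>x. c * u x)) \<in> A) \<and>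
     (\<forall>f u v. (f, u) \<in> A \<and> (f, v) \<in> A \<longrightarrow> (AE x in M. u x = v x)) \<and>
     (\<forall>f u. \<forall>g\<in>Linf M. \<forall>v\<in>Linf M.
        (f, u) \<in> A \<and> (AE x in M. f x = g x) \<and> (AE x in M. u x = v x) \<longrightarrow> (g, v) \<in> A)"

text \<open>\<open>R\<close> is a bounded two-sided inverse of \<open>\<lambda> - A : D(A) \<rightarrow> L\<^sup>\<infinity>\<close>.\<close>

definition is_resolvent ::
    "'a measure \<Rightarrow> (('a \<Rightarrow> complex) \<times> ('a \<Rightarrow> complex)) set \<Rightarrow> complex \<Rightarrow>
      (('a \<Rightarrow> complex) \<Rightarrow> ('a \<Rightarrow> complex)) \<Rightarrow> bool" where
  "is_resolvent M A l R \<longleftrightarrow>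
     bounded_op M R \<and>
     (\<forall>f\<in>Linf M. (R f, (\<lambda>x. l * R f x - f x)) \<in> A) \<and>
     (\<forall>f u. (f, u) \<in> A \<longrightarrow> (AE x in M. R (\<lambda>y. l * f y - u y) x = f x))"

definition resolvent_set ::
    "'a measure \<Rightarrow> (('a \<Rightarrow> complex) \<times> ('a \<Rightarrow> complex)) set \<Rightarrow> complex set" where
  "resolvent_set M A = {l. \<exists>R. is_resolvent M A l R}"

text \<open>Determined up to almost everywhere equality of the values.\<close>

definition resolvent ::
    "complex \<Rightarrow> 'a measure \<Rightarrow> (('a \<Rightarrow> complex) \<times> ('a \<Rightarrow> complex)) set \<Rightarrow>
      ('a \<Rightarrow> complex) \<Rightarrow> ('a \<Rightarrow> complex)" where
  "resolvent l M A = (SOME R. is_resolvent M A l R)"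

text \<open>
  For an injective contractive semigroup there is exactly one such \<open>A\<close>; the relation is used in
  place of a definite description.
\<close>

definition is_generator ::
    "'a measure \<Rightarrow> (real \<Rightarrow> ('a \<Rightarrow> complex) \<Rightarrow> ('a \<Rightarrow> complex)) \<Rightarrow>
      (('a \<Rightarrow> complex) \<times> ('a \<Rightarrow> complex)) set \<Rightarrow> bool" where
  "is_generator M T A \<longleftrightarrow>
     operator_graph M A \<and>
     (\<forall>l. 0 < Re l \<longrightarrow>
        l \<in> resolvent_set M A \<and>
        (\<forall>f\<in>Linf M. \<forall>g\<in>L1 M.
           pairing M (resolvent l M A f) g =
             (LINT t:{0<..}|lebesgue. exp (- (l * of_real t)) * pairing M (T t f) g)))"

end

theory Submission
  imports Defs
begin

text \<open>
  Write \<open>U t f\<close> for the continuous representative of \<open>T t f\<close>.  The orbit \<open>s \<mapsto> U s f x\<close> is bounded and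
  Lebesgue measurable for every \<open>x\<close>, so translation in \<open>s\<close> is continuous in \<open>L\<^sup>1\<close>, also after integrating
  over \<open>x\<close> against a finite measure equivalent to \<open>m\<close>.  If \<open>t\<^sub>n \<longlonglongrightarrow> t\<close>, then along a subsequence there is
  \<open>s < t\<close> with \<open>U (s + t\<^sub>n - t) f \<longlonglongrightarrow> U s f\<close> almost everywhere, and the strong Feller property of
  \<open>T (t - s)\<close> upgrades this to \<open>U t\<^sub>n f \<longlonglongrightarrow> U t f\<close> at every point.  Applying one more operator of the
  semigroup, positivity and Dini's argument turn pointwise into locally uniform convergence.
\<close>

section \<open>Translation in \<open>L\<^sup>1\<close> and Caratheodory functions\<close>

lemma norm_diff_le_double:
  fixes a b :: "'a::real_normed_vector"
  assumes "norm a \<le> B" "norm b \<le> B"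
  shows "norm (a - b) \<le> 2 * B"
  using norm_triangle_ineq4[of a b] assms by linarith

lemma norm_diff_le_three:
  fixes a b p q :: "'a::real_normed_vector"
  shows "norm (p - q) \<le> norm (a - p) + norm (a - b) + norm (b - q)"
  using dist_triangle[of p q a] dist_triangle[of a q b] by (simp add: dist_norm norm_minus_commute)

section \<open>Translations of the completed Lebesgue measure\<close>

lemma measurable_lebesgue_shift: "(\<lambda>s::real. s + h) \<in> lebesgue \<rightarrow>\<^sub>M lebesgue"
  using lebesgue_affine_measurable[of "\<lambda>_. 1" h] by (simp add: add.commute)

lemma distr_lebesgue_shift: "distr lebesgue lebesgue (\<lambda>s::real. s + h) = lebesgue"
proof -
  have "lebesgue = density (distr lebesgue lebesgue (\<lambda>s::real. h + 1 * s)) (\<lambda>_. ennreal \<bar>1\<bar>)"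
    by (rule lebesgue_real_affine) simp
  then show ?thesis
    by (simp add: density_1 add.commute)
qed

lemma lebesgue_integral_shift:
  fixes f :: "real \<Rightarrow> 'b::{banach, second_countable_topology}"
  assumes "f \<in> borel_measurable lebesgue"
  shows "(LINT s|lebesgue. f (s + h)) = (LINT s|lebesgue. f s)"
  using integral_distr[OF measurable_lebesgue_shift assms, of h] by (simp add: distr_lebesgue_shift)

lemma lebesgue_measurable_shift:
  fixes f :: "real \<Rightarrow> 'b::topological_space"
  assumes "f \<in> borel_measurable lebesgue"
  shows "(\<lambda>s. f (s + h)) \<in> borel_measurable lebesgue"
  by (rule measurable_compose[OF measurable_lebesgue_shift assms])

text \<open>A Lebesgue measurable function is an almost everywhere limit of continuous functions.
  Cutting these off at the level \<open>B\<close> does not disturb the limit and makes them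
  uniformly bounded, so dominated convergence applies on the bounded interval.\<close>

lemma bounded_continuous_L1_approximation:
  fixes \<psi> :: "real \<Rightarrow> complex"
  assumes \<psi>[measurable]: "\<psi> \<in> borel_measurable lebesgue" and bound: "\<And>s. norm (\<psi> s) \<le> B"
    and e: "e > 0"
  obtains c where "continuous_on UNIV c" "\<And>s. norm (c s) \<le> B"
    "(LINT s|lebesgue_on {a..b}. norm (c s - \<psi> s)) < e"
proof (cases "B > 0")
  case False
  then have "\<psi> s = 0" for s
    using bound[of s] by (meson norm_le_zero_iff not_le_imp_less order_trans)
  then show thesis
    using that[of "\<lambda>_. 0"] e bound[of 0] by simp
next
  case B: True
  have "\<psi> measurable_on UNIV"
    using \<psi> by (intro lebesgue_measurable_imp_measurable_on) auto
  then obtain N g where N: "negligible N" and g: "\<And>n. continuous_on UNIV (g n)"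
    and lim: "\<And>s. s \<notin> N \<Longrightarrow> (\<lambda>n. g n s) \<longlonglongrightarrow> \<psi> s"
    unfolding measurable_on_def by auto
  \<comment> \<open>Radial projection of \<open>g n s\<close> onto the ball of radius
    \<open>B\<close>. It is continuous because the denominator is at least \<open>B > 0\<close>, and
    it fixes the values of \<open>\<psi>\<close>.\<close>
  define c where "c n s = of_real (B / max B (norm (g n s))) * g n s" for n s
  have c_cont: "continuous_on UNIV (c n)" for n
    unfolding c_def using B by (intro continuous_intros g) auto
  have c_bound: "norm (c n s) \<le> B" for n s
  proof -
    have "norm (c n s) = B * norm (g n s) / max B (norm (g n s))"
      using B by (simp add: c_def norm_mult norm_divide)
    also have "\<dots> \<le> B"
      using B by (simp add: divide_le_eq)
    finally show ?thesis .
  qed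
  have c_lim: "(\<lambda>n. c n s) \<longlonglongrightarrow> \<psi> s" if "s \<notin> N" for s
  proof -
    have "(\<lambda>n. c n s) \<longlonglongrightarrow> of_real (B / max B (norm (\<psi> s))) * \<psi> s"
      unfolding c_def using B by (intro tendsto_intros lim that) auto
    moreover have "max B (norm (\<psi> s)) = B"
      using bound by (simp add: max_absorb1)
    ultimately show ?thesis using B by simp
  qed
  have [measurable]: "c n \<in> borel_measurable lebesgue" for n
    using borel_measurable_continuous_onI[OF c_cont] by (intro measurable_completion) simp
  have "(\<lambda>n. LINT s|lebesgue_on {a..b}. norm (c n s - \<psi> s)) \<longlonglongrightarrow> (LINT s|lebesgue_on {a..b}. 0)"
  proof (rule integral_dominated_convergence[where w = "\<lambda>_. 2 * B"])
    show "(\<lambda>s. norm (c n s - \<psi> s)) \<in> borel_measurable (lebesgue_on {a..b})" for n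
      by (intro measurable_restrict_space1) measurable
    have "AE s in lebesgue. s \<notin> N"
      using N by (simp add: AE_not_in negligible_iff_null_sets)
    then have "AE s in lebesgue_on {a..b}. s \<notin> N"
      by (subst AE_restrict_space_iff) auto
    then show "AE s in lebesgue_on {a..b}. (\<lambda>n. norm (c n s - \<psi> s)) \<longlonglongrightarrow> 0"
    proof eventually_elim
      case (elim s)
      show ?case
        using tendsto_norm[OF tendsto_diff[OF c_lim[OF elim] tendsto_const[of "\<psi> s"]]] by simp
    qed
    have "norm (c n s - \<psi> s) \<le> 2 * B" for n s
      by (intro norm_diff_le_double c_bound bound)
    then show "AE s in lebesgue_on {a..b}. norm (norm (c n s - \<psi> s)) \<le> 2 * B" for n
      by simp
  qed auto
  then have "eventually (\<lambda>n. (LINT s|lebesgue_on {a..b}. norm (c n s - \<psi> s)) < e) sequentially"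
    using e by (intro order_tendstoD(2)) auto
  then obtain n where "(LINT s|lebesgue_on {a..b}. norm (c n s - \<psi> s)) < e"
    using eventually_happens'[OF sequentially_bot] by blast
  from that[OF c_cont c_bound this] show thesis .
qed

lemma integrable_lebesgue_on_bounded:
  fixes f :: "real \<Rightarrow> 'b::{banach, second_countable_topology}"
  assumes "f \<in> borel_measurable lebesgue" "\<And>s. norm (f s) \<le> B"
  shows "integrable (lebesgue_on {a..b}) f"
proof -
  interpret finite_measure "lebesgue_on {a..b}"
    by (intro finite_measure_lebesgue_on) auto
  show ?thesis
    using assms by (intro integrable_const_bound[where B = B] measurable_restrict_space1) auto
qed

text \<open>Density argument. A continuous bounded \<open>c\<close> close to \<open>\<psi>\<close>
  in mean has convergent translates by dominated convergence, and translation invariance keeps the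
  shifted error as small as the unshifted one. This gives three terms below
  \<open>e / 3\<close>.\<close>

lemma shift_integral_tendsto:
  fixes \<psi> :: "real \<Rightarrow> complex"
  assumes \<psi>[measurable]: "\<psi> \<in> borel_measurable lebesgue" and bound: "\<And>s. norm (\<psi> s) \<le> B"
    and h: "h \<longlonglongrightarrow> (0::real)"
  shows "(\<lambda>n. LINT s|lebesgue_on {a..b}. norm (\<psi> (s + h n) - \<psi> s)) \<longlonglongrightarrow> 0"
proof (rule tendstoI)
  fix e :: real assume e: "e > 0"
  \<comment> \<open>The interval is enlarged by 1 at both ends so that it contains
    \<open>s + k\<close> for all \<open>s\<close> in \<open>{a..b}\<close> and
    \<open>\<bar>k\<bar> \<le> 1\<close>.\<close>
  obtain c where c: "continuous_on UNIV c" and c_bound: "\<And>s. norm (c s) \<le> B"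
    and c_close: "(LINT s|lebesgue_on {a-1..b+1}. norm (c s - \<psi> s)) < e / 3"
    by (rule bounded_continuous_L1_approximation[OF \<psi> bound, of "e/3" "a-1" "b+1"]) (use e in auto)
  have c_meas[measurable]: "c \<in> borel_measurable lebesgue"
    using borel_measurable_continuous_onI[OF c] by (intro measurable_completion) simp
  have shift_close: "(LINT s|lebesgue_on {a..b}. norm (c (s + k) - \<psi> (s + k))) < e / 3"
    if "\<bar>k\<bar> \<le> 1" for k
  proof -
    have B0: "B \<ge> 0" using bound[of 0] norm_ge_zero order_trans by blast
    let ?F = "\<lambda>s. indicat_real {a-1..b+1} s * norm (c s - \<psi> s)"
    have "integrable (lebesgue_on {a-1..b+1}) (\<lambda>s. norm (c s - \<psi> s))"
      by (rule integrable_lebesgue_on_bounded[where B = "2*B"])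
        (auto intro!: norm_diff_le_double bound c_bound)
    then have F_int: "integrable lebesgue ?F"
      by (simp add: integrable_restrict_space)
    have Fs_int: "integrable lebesgue (\<lambda>s. ?F (s + k))"
      using integrable_distr[OF measurable_lebesgue_shift, of k ?F] F_int
      by (simp only: distr_lebesgue_shift)
    have "(LINT s|lebesgue_on {a..b}. norm (c (s + k) - \<psi> (s + k)))
        = (LINT s|lebesgue. indicat_real {a..b} s * norm (c (s + k) - \<psi> (s + k)))"
      by (simp add: integral_restrict_space)
    also have "\<dots> \<le> (LINT s|lebesgue. ?F (s + k))"
    proof (rule integral_mono')
      show "integrable lebesgue (\<lambda>s. ?F (s + k))" by (fact Fs_int)
    qed (use that in \<open>auto simp: indicator_def\<close>)
    also have "\<dots> = (LINT s|lebesgue. ?F s)"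
      by (intro lebesgue_integral_shift borel_measurable_times borel_measurable_indicator) (simp, measurable)
    also have "\<dots> = (LINT s|lebesgue_on {a-1..b+1}. norm (c s - \<psi> s))"
      by (simp add: integral_restrict_space)
    finally show ?thesis using c_close by simp
  qed
  have close: "(LINT s|lebesgue_on {a..b}. norm (c s - \<psi> s)) < e / 3"
    using shift_close[of 0] by simp
  have "(\<lambda>n. LINT s|lebesgue_on {a..b}. norm (c (s + h n) - c s)) \<longlonglongrightarrow> (LINT s|lebesgue_on {a..b}. 0)"
  proof (rule integral_dominated_convergence[where w = "\<lambda>_. 2 * B"])
    have [measurable]: "(\<lambda>s. c (s + h n)) \<in> borel_measurable lebesgue" for n
      by (rule lebesgue_measurable_shift[OF c_meas])
    show "(\<lambda>s. norm (c (s + h n) - c s)) \<in> borel_measurable (lebesgue_on {a..b})" for n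
      by (intro measurable_restrict_space1) measurable
    have "(\<lambda>n. norm (c (s + h n) - c s)) \<longlonglongrightarrow> 0" for s
    proof -
      have "(\<lambda>n. c (s + h n)) \<longlonglongrightarrow> c (s + 0)"
        by (rule continuous_on_tendsto_compose[OF c tendsto_add[OF tendsto_const h]]) auto
      from tendsto_norm[OF tendsto_diff[OF this tendsto_const[of "c s"]]] show ?thesis by simp
    qed
    then show "AE s in lebesgue_on {a..b}. (\<lambda>n. norm (c (s + h n) - c s)) \<longlonglongrightarrow> 0" by simp
    show "AE s in lebesgue_on {a..b}. norm (norm (c (s + h n) - c s)) \<le> 2 * B" for n
      by (auto intro!: norm_diff_le_double c_bound)
  qed auto
  then have "eventually (\<lambda>n. (LINT s|lebesgue_on {a..b}. norm (c (s + h n) - c s)) < e / 3) sequentially"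
    using e by (intro order_tendstoD(2)) auto
  moreover have "eventually (\<lambda>n. \<bar>h n\<bar> \<le> 1) sequentially"
    using tendstoD[OF h zero_less_one] by eventually_elim simp
  ultimately show "eventually (\<lambda>n. dist (LINT s|lebesgue_on {a..b}. norm (\<psi> (s + h n) - \<psi> s)) 0 < e) sequentially"
  proof eventually_elim
    case (elim n)
    let ?L = "lebesgue_on {a..b}"
    have [measurable]: "(\<lambda>s. \<psi> (s + h n)) \<in> borel_measurable lebesgue"
      "(\<lambda>s. c (s + h n)) \<in> borel_measurable lebesgue"
      by (rule lebesgue_measurable_shift[OF \<psi>], rule lebesgue_measurable_shift[OF c_meas])
    have int: "integrable ?L (\<lambda>s. norm (c (s + h n) - \<psi> (s + h n)))"
      "integrable ?L (\<lambda>s. norm (c (s + h n) - c s))"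
      "integrable ?L (\<lambda>s. norm (c s - \<psi> s))"
      by (rule integrable_lebesgue_on_bounded[where B = "2 * B"],
          measurable, simp add: norm_diff_le_double bound c_bound)+
    have "(LINT s|?L. norm (\<psi> (s + h n) - \<psi> s)) \<le>
      (LINT s|?L. norm (c (s + h n) - \<psi> (s + h n)) + norm (c (s + h n) - c s)
         + norm (c s - \<psi> s))"
    proof (rule integral_mono')
      fix s
      show "norm (\<psi> (s + h n) - \<psi> s) \<le> norm (c (s + h n) - \<psi> (s + h n))
          + norm (c (s + h n) - c s) + norm (c s - \<psi> s)"
        using norm_diff_le_three[of "\<psi> (s + h n)" "\<psi> s" "c (s + h n)" "c s"] by simp
    qed (use int in auto)
    also have "\<dots> = (LINT s|?L. norm (c (s + h n) - \<psi> (s + h n))) + (LINT s|?L. norm (c (s + h n) - c s))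
         + (LINT s|?L. norm (c s - \<psi> s))"
      using int by simp
    also have "\<dots> < e / 3 + e / 3 + e / 3"
      using elim(1) shift_close[OF elim(2)] close by (intro add_strict_mono)
    finally have "(LINT s|?L. norm (\<psi> (s + h n) - \<psi> s)) < e" by simp
    moreover have "0 \<le> (LINT s|?L. norm (\<psi> (s + h n) - \<psi> s))"
      by (rule integral_nonneg_AE) simp
    ultimately show ?case by (simp only: dist_real_def diff_zero abs_of_nonneg)
  qed
qed

section \<open>Joint measurability of Caratheodory functions\<close>

text \<open>Replacing \<open>x\<close> by a nearby point of a countable dense set leaves countably
  many functions of \<open>s\<close>, glued along measurable sets of \<open>x\<close>. Refining the
  approximation recovers \<open>u\<close> by continuity in \<open>x\<close>.\<close>

lemma caratheodory_measurable:
  fixes u :: "'b \<Rightarrow> 'a::{metric_space, second_countable_topology} \<Rightarrow> 'c::metric_space"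
  assumes meas: "\<And>x. (\<lambda>s. u s x) \<in> borel_measurable N"
    and cont: "\<And>s. continuous_on UNIV (u s)"
  shows "(\<lambda>(s, x). u s x) \<in> borel_measurable (N \<Otimes>\<^sub>M borel)"
proof -
  obtain D :: "'a set" where D: "countable D" "\<And>X. open X \<Longrightarrow> X \<noteq> {} \<Longrightarrow> \<exists>d\<in>D. d \<in> X"
    using countable_dense_exists by blast
  have "D \<noteq> {}" using D(2)[of UNIV] by auto
  define d where "d = from_nat_into D"
  have d: "\<exists>k. dist x (d k) < e" if "e > 0" for x e
    using D(2)[of "ball x e"] that D(1) \<open>D \<noteq> {}\<close> unfolding d_def
    by (metis centre_in_ball empty_iff from_nat_into_surj mem_ball open_ball)
  \<comment> \<open>Taking the least admissible index makes the choice of a dense point a measurable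
    function of \<open>x\<close>.\<close>
  define \<kappa> where "\<kappa> n x = (LEAST k. dist x (d k) < inverse (real (Suc n)))" for n x
  have \<kappa>: "dist x (d (\<kappa> n x)) < inverse (real (Suc n))" for n x
    unfolding \<kappa>_def by (rule LeastI_ex) (rule d, simp)
  have \<kappa>_meas[measurable]: "\<kappa> n \<in> borel \<rightarrow>\<^sub>M count_space UNIV" for n
    unfolding \<kappa>_def by measurable
  have "(\<lambda>n. d (\<kappa> n x)) \<longlonglongrightarrow> x" for x
  proof (rule metric_LIMSEQ_I)
    fix e :: real assume "e > 0"
    then obtain n where n: "inverse (real (Suc n)) < e" using reals_Archimedean by blast
    have "dist (d (\<kappa> m x)) x < e" if "m \<ge> n" for m
    proof -
      have "inverse (real (Suc m)) \<le> inverse (real (Suc n))" using that by (simp add: field_simps)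
      then show ?thesis using \<kappa>[of x m] n by (metis dist_commute less_le_trans less_trans)
    qed
    then show "\<exists>n. \<forall>m\<ge>n. dist (d (\<kappa> m x)) x < e" by blast
  qed
  then have lim: "(\<lambda>n. u s (d (\<kappa> n x))) \<longlonglongrightarrow> u s x" for s x
    by (rule continuous_on_tendsto_compose[OF cont]) auto
  show ?thesis
  proof (rule borel_measurable_LIMSEQ_metric[where f = "\<lambda>n (s, x). u s (d (\<kappa> n x))"])
    fix n
    have "(\<lambda>p. u (fst p) (d (\<kappa> n (snd p)))) \<in> borel_measurable (N \<Otimes>\<^sub>M borel)"
    proof (rule measurable_compose_countable[where f = "\<lambda>k p. u (fst p) (d k)"])
      show "(\<lambda>p. u (fst p) (d k)) \<in> borel_measurable (N \<Otimes>\<^sub>M borel)" for k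
        by (rule measurable_compose[OF measurable_fst meas])
    qed measurable
    then show "(\<lambda>(s, x). u s (d (\<kappa> n x))) \<in> borel_measurable (N \<Otimes>\<^sub>M borel)"
      by (simp add: case_prod_beta')
  qed (use lim in auto)
qed

section \<open>Positive strong Feller contractions\<close>

lemma Linf_norm_le_iff:
  assumes "f \<in> borel_measurable M" "0 \<le> B"
  shows "Linf_norm M f \<le> ennreal B \<longleftrightarrow> (AE x in M. norm (f x) \<le> B)"
proof
  assume le: "Linf_norm M f \<le> ennreal B"
  have "AE x in M. ennreal (norm (f x)) \<le> Linf_norm M f"
    unfolding Linf_norm_def by (rule esssup_AE)
  then show "AE x in M. norm (f x) \<le> B"
  proof eventually_elim
    case (elim x)
    from order_trans[OF this le] assms(2) show ?case by simp
  qed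
next
  assume "AE x in M. norm (f x) \<le> B"
  then show "Linf_norm M f \<le> ennreal B"
    unfolding Linf_norm_def by (intro esssup_I) (use assms in \<open>auto simp: ennreal_leI\<close>)
qed

lemma LinfI:
  assumes "f \<in> borel_measurable M" "AE x in M. norm (f x) \<le> B"
  shows "f \<in> Linf M"
proof -
  have "AE x in M. norm (f x) \<le> max 0 B"
    using assms(2) by eventually_elim simp
  then have "Linf_norm M f \<le> ennreal (max 0 B)"
    using Linf_norm_le_iff[OF assms(1), of "max 0 B"] by simp
  also have "\<dots> < \<infinity>" by simp
  finally show ?thesis using assms(1) by (simp add: Linf_def)
qed

lemma Linf_measurable: "f \<in> Linf M \<Longrightarrow> f \<in> borel_measurable M"
  by (simp add: Linf_def)

lemma LinfE:
  assumes "f \<in> Linf M"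
  obtains B where "B > 0" "AE x in M. norm (f x) \<le> B"
proof -
  have fin: "Linf_norm M f < \<infinity>" and meas: "f \<in> borel_measurable M"
    using assms by (auto simp: Linf_def)
  define B where "B = enn2real (Linf_norm M f)"
  have "Linf_norm M f \<le> ennreal B"
    unfolding B_def using fin by simp
  then have "AE x in M. norm (f x) \<le> B"
    using Linf_norm_le_iff[OF meas, of B] by (simp add: B_def)
  \<comment> \<open>Adding 1 makes the bound strictly positive, so that later scalings may divide by
    it.\<close>
  then have "AE x in M. norm (f x) \<le> B + 1"
    by eventually_elim simp
  moreover have "B + 1 > 0" by (simp add: B_def add_nonneg_pos)
  ultimately show thesis by (rule that[rotated])
qed

lemma Linf_add: "f \<in> Linf M \<Longrightarrow> g \<in> Linf M \<Longrightarrow> (\<lambda>x. f x + g x) \<in> Linf M"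
proof -
  assume fg: "f \<in> Linf M" "g \<in> Linf M"
  from LinfE[OF fg(1)] obtain B where B: "AE x in M. norm (f x) \<le> B" by metis
  from LinfE[OF fg(2)] obtain C where C: "AE x in M. norm (g x) \<le> C" by metis
  have "AE x in M. norm (f x + g x) \<le> B + C"
    using B C by eventually_elim (rule norm_triangle_mono)
  then show "(\<lambda>x. f x + g x) \<in> Linf M"
    using fg[THEN Linf_measurable] by (intro LinfI) measurable
qed

lemma Linf_cmult: "f \<in> Linf M \<Longrightarrow> (\<lambda>x. c * f x) \<in> Linf M"
proof -
  assume f: "f \<in> Linf M"
  from LinfE[OF f] obtain B where B: "AE x in M. norm (f x) \<le> B" by metis
  then have "AE x in M. norm (c * f x) \<le> norm c * B"
    by eventually_elim (simp add: norm_mult mult_left_mono)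
  then show "(\<lambda>x. c * f x) \<in> Linf M"
    using Linf_measurable[OF f] by (intro LinfI) measurable
qed

lemma Linf_diff: "f \<in> Linf M \<Longrightarrow> g \<in> Linf M \<Longrightarrow> (\<lambda>x. f x - g x) \<in> Linf M"
  using Linf_add[of f M "\<lambda>x. (- 1) * g x"] Linf_cmult[of g M "- 1"] by simp

section \<open>Full support and uniqueness of continuous representatives\<close>

locale full_support_measure =
  fixes M :: "'a::metric_space measure"
  assumes sets_M: "sets M = sets borel" and full: "full_support M"
begin

lemma space_M[simp]: "space M = UNIV"
  using sets_eq_imp_space_eq[OF sets_M] by simp

lemma continuous_measurable: "continuous_on UNIV h \<Longrightarrow> h \<in> borel_measurable M"
  using borel_measurable_continuous_onI measurable_cong_sets[OF sets_M refl] by blast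

text \<open>The points sent outside \<open>S\<close> form an open null set. Were it nonempty, it
  would contain a ball, which has positive measure by full support.\<close>

lemma AE_closed_imp_all:
  assumes h: "continuous_on UNIV h" and S: "closed S" and ae: "AE x in M. h x \<in> S"
  shows "h x \<in> S"
proof (rule ccontr)
  assume "h x \<notin> S"
  have op: "open (h -` (- S))"
    using S h by (intro open_vimage) (auto simp: continuous_on_eq_continuous_at)
  then obtain r where r: "r > 0" "ball x r \<subseteq> h -` (- S)"
    using \<open>h x \<notin> S\<close> open_contains_ball by blast
  have "AE y in M. y \<notin> ball x r"
    using ae by eventually_elim (use r in auto)
  moreover have "ball x r \<in> sets M" by (simp add: sets_M)
  ultimately have "emeasure M (ball x r) = 0"
    by (subst (asm) AE_iff_measurable[of "ball x r"]) auto
  with full r(1) show False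
    unfolding full_support_def by (metis less_irrefl)
qed

lemma AE_eq_imp_eq:
  fixes g h :: "'a \<Rightarrow> complex"
  assumes "continuous_on UNIV g" "continuous_on UNIV h" "AE x in M. g x = h x"
  shows "g = h"
proof
  fix x
  have "g x - h x \<in> {0}"
    by (rule AE_closed_imp_all[where h = "\<lambda>x. g x - h x"])
      (use assms in \<open>auto intro!: continuous_intros\<close>)
  then show "g x = h x" by simp
qed

text \<open>Full support supplies the uniqueness that the definite description in
  \<open>Cb_rep\<close> needs.\<close>

lemma Cb_rep_eqI:
  assumes "continuous_on UNIV h" "\<And>x. norm (h x) \<le> B" "AE x in M. f x = h x"
  shows "Cb_rep M f = h"
  unfolding Cb_rep_def
proof (rule the_equality)
  show "Cb_representative M f h"
    unfolding Cb_representative_def using assms by (auto intro: bcontfun_normI)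
next
  fix k assume "Cb_representative M f k"
  then have k: "continuous_on UNIV k" "AE x in M. f x = k x"
    by (auto simp: Cb_representative_def bcontfun_def)
  have "AE x in M. k x = h x" using k(2) assms(3) by eventually_elim simp
  then show "k = h" by (intro AE_eq_imp_eq k assms)
qed

end

section \<open>Pointwise calculus for a single operator\<close>

locale feller_contraction = full_support_measure M
  for M :: "'a::metric_space measure" +
  fixes K :: "('a \<Rightarrow> complex) \<Rightarrow> ('a \<Rightarrow> complex)"
  assumes feller: "strong_feller M K" and positive: "positive_op M K"
    and contraction: "op_norm M K \<le> 1"
begin

text \<open>The laws of \<open>K\<close> hold only almost everywhere. Those of \<open>rep\<close>
  hold at every point, which is where convergence is to be shown.\<close>

definition rep :: "('a \<Rightarrow> complex) \<Rightarrow> 'a \<Rightarrow> complex" where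
  "rep f = Cb_rep M (K f)"

lemma linear: "linear_op M K"
  using feller by (simp add: strong_feller_def bounded_op_def)

lemma rep_representative:
  assumes "f \<in> Linf M"
  shows "continuous_on UNIV (rep f)" "bounded (range (rep f))" "AE x in M. K f x = rep f x"
proof -
  obtain h where h: "Cb_representative M (K f) h"
    using feller assms by (auto simp: strong_feller_def)
  then have *: "continuous_on UNIV h" "bounded (range h)" "AE x in M. K f x = h x"
    by (auto simp: Cb_representative_def bcontfun_def)
  then obtain B where "\<And>x. norm (h x) \<le> B" by (auto simp: bounded_iff)
  then have "rep f = h"
    unfolding rep_def using * by (intro Cb_rep_eqI)
  with * show "continuous_on UNIV (rep f)" "bounded (range (rep f))" "AE x in M. K f x = rep f x"
    by simp_all
qed

text \<open>Scaling by \<open>1 / B\<close> moves \<open>f\<close> into the unit ball, over which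
  \<open>op_norm\<close> is a supremum. The resulting almost everywhere bound extends to all points
  because \<open>cball 0 B\<close> is closed.\<close>

lemma rep_bound:
  assumes f: "f \<in> borel_measurable M" and B: "B > 0" and bound: "AE x in M. norm (f x) \<le> B"
  shows "norm (rep f x) \<le> B"
proof -
  have fL: "f \<in> Linf M" using f bound by (rule LinfI)
  let ?g = "\<lambda>y. complex_of_real (1 / B) * f y"
  have gL: "?g \<in> Linf M" using fL by (rule Linf_cmult)
  have "AE x in M. norm (?g x) \<le> 1"
    using bound by eventually_elim (use B in \<open>simp add: norm_mult norm_divide\<close>)
  then have "Linf_norm M ?g \<le> 1"
    using Linf_norm_le_iff[of ?g M 1] f by simp
  then have "Linf_norm M (K ?g) \<le> op_norm M K"
    unfolding op_norm_def using gL by (intro SUP_upper) simp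
  also note contraction
  finally have "Linf_norm M (K ?g) \<le> ennreal 1" by simp
  moreover have "K ?g \<in> borel_measurable M"
    using linear gL by (auto simp: linear_op_def dest: Linf_measurable)
  ultimately have 1: "AE x in M. norm (K ?g x) \<le> 1"
    using Linf_norm_le_iff[of "K ?g" M 1] by simp
  have 2: "AE x in M. K ?g x = complex_of_real (1 / B) * K f x"
    using linear fL unfolding linear_op_def by blast
  have "AE x in M. rep f x \<in> cball 0 B"
    using 1 2 rep_representative(3)[OF fL]
  proof eventually_elim
    case (elim x)
    then have "norm (K f x) / B \<le> 1" using B by (simp add: norm_mult norm_divide)
    then show ?case using elim B by (simp add: divide_le_eq)
  qed
  then have "rep f x \<in> cball 0 B"
    by (rule AE_closed_imp_all[OF rep_representative(1)[OF fL] closed_cball])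
  then show ?thesis by simp
qed

lemma rep_Linf: "f \<in> Linf M \<Longrightarrow> rep f \<in> Linf M"
proof -
  assume f: "f \<in> Linf M"
  obtain B where "\<And>x. norm (rep f x) \<le> B"
    using rep_representative(2)[OF f] by (auto simp: bounded_iff)
  then show "rep f \<in> Linf M"
    by (intro LinfI[where B = B] continuous_measurable rep_representative f) auto
qed

text \<open>Through this uniqueness principle the almost everywhere identities for \<open>K\<close>
  become equalities of functions.\<close>

lemma rep_eqI:
  assumes f: "f \<in> Linf M" and h: "continuous_on UNIV h" "AE x in M. K f x = h x"
  shows "rep f = h"
proof (rule AE_eq_imp_eq)
  show "AE x in M. rep f x = h x"
    using rep_representative(3)[OF f] h(2) by eventually_elim simp
qed (use f h rep_representative in auto)

lemma rep_cong:
  assumes fg: "f \<in> Linf M" "g \<in> Linf M" and "AE x in M. f x = g x"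
  shows "rep f = rep g"
proof (rule rep_eqI)
  have "AE x in M. K f x = K g x" using linear assms by (auto simp: linear_op_def)
  then show "AE x in M. K f x = rep g x"
    using rep_representative(3)[OF fg(2)] by eventually_elim simp
qed (use fg rep_representative in auto)

lemma rep_add:
  assumes fg: "f \<in> Linf M" "g \<in> Linf M"
  shows "rep (\<lambda>x. f x + g x) = (\<lambda>x. rep f x + rep g x)"
proof (rule rep_eqI)
  have "AE x in M. K (\<lambda>y. f y + g y) x = K f x + K g x"
    using linear assms by (auto simp: linear_op_def)
  then show "AE x in M. K (\<lambda>x. f x + g x) x = rep f x + rep g x"
    using rep_representative(3)[OF fg(1)] rep_representative(3)[OF fg(2)] by eventually_elim simp
qed (use fg rep_representative in \<open>auto intro!: Linf_add continuous_intros\<close>)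

lemma rep_cmult:
  assumes f: "f \<in> Linf M"
  shows "rep (\<lambda>x. c * f x) = (\<lambda>x. c * rep f x)"
proof (rule rep_eqI)
  have "AE x in M. K (\<lambda>y. c * f y) x = c * K f x"
    using linear assms by (auto simp: linear_op_def)
  then show "AE x in M. K (\<lambda>x. c * f x) x = c * rep f x"
    using rep_representative(3)[OF f] by eventually_elim simp
qed (use f rep_representative in \<open>auto intro!: Linf_cmult continuous_intros\<close>)

lemma rep_diff:
  assumes fg: "f \<in> Linf M" "g \<in> Linf M"
  shows "rep (\<lambda>x. f x - g x) = (\<lambda>x. rep f x - rep g x)"
  using rep_add[OF fg(1) Linf_cmult[OF fg(2), of "- 1"]] rep_cmult[OF fg(2), of "- 1"] by simp

lemma rep_nonneg:
  assumes f: "f \<in> Linf M" "AE x in M. f x \<in> \<real>\<^sub>\<ge>\<^sub>0"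
  shows "rep f x \<in> \<real>\<^sub>\<ge>\<^sub>0"
proof (rule AE_closed_imp_all)
  have "AE x in M. K f x \<in> \<real>\<^sub>\<ge>\<^sub>0" using positive f by (auto simp: positive_op_def)
  then show "AE x in M. rep f x \<in> \<real>\<^sub>\<ge>\<^sub>0"
    using rep_representative(3)[OF f(1)] by eventually_elim simp
qed (use f rep_representative in auto)

text \<open>Positivity is applied to \<open>k - f\<close> and to \<open>k + f\<close>. As both
  images are real and nonnegative, the image of \<open>f\<close> is real and lies between plus and
  minus the image of \<open>k\<close>.\<close>

lemma rep_dominated_real:
  assumes f: "(\<lambda>x. complex_of_real (f x)) \<in> Linf M" and k: "(\<lambda>x. complex_of_real (k x)) \<in> Linf M"
    and le: "\<And>x. \<bar>f x\<bar> \<le> k x"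
  shows "norm (rep (\<lambda>x. complex_of_real (f x)) x) \<le> Re (rep (\<lambda>x. complex_of_real (k x)) x)"
proof -
  let ?f = "\<lambda>x. complex_of_real (f x)" and ?k = "\<lambda>x. complex_of_real (k x)"
  have "k x - f x \<ge> 0" "k x + f x \<ge> 0" for x
    using le[of x] by linarith+
  then have "?k x - ?f x \<in> \<real>\<^sub>\<ge>\<^sub>0" "?k x + ?f x \<in> \<real>\<^sub>\<ge>\<^sub>0" for x
    by (simp_all flip: of_real_diff of_real_add)
  then have "rep (\<lambda>x. ?k x - ?f x) x \<in> \<real>\<^sub>\<ge>\<^sub>0" "rep (\<lambda>x. ?k x + ?f x) x \<in> \<real>\<^sub>\<ge>\<^sub>0"
    by (intro rep_nonneg Linf_diff Linf_add f k; simp)+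
  then have *: "rep ?k x - rep ?f x \<in> \<real>\<^sub>\<ge>\<^sub>0" "rep ?k x + rep ?f x \<in> \<real>\<^sub>\<ge>\<^sub>0"
    by (simp_all add: rep_diff rep_add f k)
  then have "Im (rep ?f x) = 0" "\<bar>Re (rep ?f x)\<bar> \<le> Re (rep ?k x)"
    by (auto simp: complex_nonneg_Reals_iff)
  then show ?thesis by (simp add: cmod_def)
qed

text \<open>The factor 2 comes from estimating real and imaginary parts separately. It is harmless,
  since the bound serves only to force convergence to zero.\<close>

lemma rep_dominated:
  assumes f: "f \<in> Linf M" and k: "(\<lambda>x. complex_of_real (k x)) \<in> Linf M"
    and le: "\<And>x. norm (f x) \<le> k x"
  shows "norm (rep f x) \<le> 2 * Re (rep (\<lambda>x. complex_of_real (k x)) x)"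
proof -
  obtain B where B: "AE x in M. norm (f x) \<le> B" using LinfE[OF f] by metis
  note meas = Linf_measurable[OF f]
  have re: "(\<lambda>x. complex_of_real (Re (f x))) \<in> Linf M"
  proof (rule LinfI)
    show "AE x in M. norm (complex_of_real (Re (f x))) \<le> B"
      using B by eventually_elim (use abs_Re_le_cmod order_trans in \<open>simp, blast\<close>)
  qed (use meas in measurable)
  have im: "(\<lambda>x. complex_of_real (Im (f x))) \<in> Linf M"
  proof (rule LinfI)
    show "AE x in M. norm (complex_of_real (Im (f x))) \<le> B"
      using B by eventually_elim (use abs_Im_le_cmod order_trans in \<open>simp, blast\<close>)
  qed (use meas in measurable)
  have "f = (\<lambda>x. complex_of_real (Re (f x)) + \<i> * complex_of_real (Im (f x)))"
    by (auto simp: complex_eq[symmetric])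
  then have "rep f x = rep (\<lambda>x. complex_of_real (Re (f x))) x + \<i> * rep (\<lambda>x. complex_of_real (Im (f x))) x"
    using rep_add[OF re Linf_cmult[OF im, of \<i>]] rep_cmult[OF im, of \<i>] by metis
  then have "norm (rep f x) \<le> norm (rep (\<lambda>x. complex_of_real (Re (f x))) x)
      + norm (rep (\<lambda>x. complex_of_real (Im (f x))) x)"
    by (metis norm_triangle_ineq norm_mult norm_ii mult_1)
  also have "\<dots> \<le> Re (rep (\<lambda>x. complex_of_real (k x)) x) + Re (rep (\<lambda>x. complex_of_real (k x)) x)"
    by (intro add_mono rep_dominated_real re im k)
      (use le abs_Re_le_cmod abs_Im_le_cmod order_trans in blast)+
  finally show ?thesis by simp
qed

text \<open>Sequential continuity from the strong Feller property, with the bounded supremum of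
  norms replaced by a common almost everywhere bound.\<close>

lemma rep_tendsto:
  assumes G: "\<And>n. G n \<in> borel_measurable M" and g: "g \<in> Linf M"
    and bound: "\<And>n. AE x in M. norm (G n x) \<le> B"
    and lim: "AE x in M. (\<lambda>n. G n x) \<longlonglongrightarrow> g x"
  shows "(\<lambda>n. rep (G n) x) \<longlonglongrightarrow> rep g x"
proof -
  have GL: "G n \<in> Linf M" for n using G bound by (rule LinfI)
  have "AE x in M. norm (G n x) \<le> max 0 B" for n
    using bound[of n] by eventually_elim simp
  then have "Linf_norm M (G n) \<le> ennreal (max 0 B)" for n
    using Linf_norm_le_iff[OF G, of "max 0 B"] by simp
  then have "(SUP n. Linf_norm M (G n)) \<le> ennreal (max 0 B)"
    by (intro SUP_least)
  also have "\<dots> < \<infinity>" by simp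
  finally have "(SUP n. Linf_norm M (G n)) < \<infinity>" .
  with feller GL lim g show ?thesis
    unfolding strong_feller_def rep_def by blast
qed

text \<open>Dini's argument: the tail suprema \<open>H n\<close> decrease to zero, and so do their continuous images,
  which by positivity dominate \<open>rep (G n) - rep g\<close>.\<close>

lemma rep_continuous_convergence:
  assumes G: "\<And>n. G n \<in> borel_measurable M" and g: "g \<in> borel_measurable M"
    and G_bound: "\<And>n y. norm (G n y) \<le> B" and g_bound: "\<And>y. norm (g y) \<le> B"
    and lim: "\<And>y. (\<lambda>n. G n y) \<longlonglongrightarrow> g y"
    and x: "\<xi> \<longlonglongrightarrow> x"
  shows "(\<lambda>n. rep (G n) (\<xi> n)) \<longlonglongrightarrow> rep g x"
proof -
  have GL: "G n \<in> Linf M" for n using G G_bound by (intro LinfI[where B = B]) auto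
  have gL: "g \<in> Linf M" using g g_bound by (intro LinfI[where B = B]) auto
  have d_bound: "norm (G n y - g y) \<le> 2 * B" for n y
    using norm_triangle_ineq4[of "G n y" "g y"] G_bound[of n y] g_bound[of y] by linarith
  \<comment> \<open>The bounds hold at every point, so this is a supremum of a bounded set of reals
    everywhere. Being countable, it is measurable.\<close>
  define H where "H n y = (SUP j. norm (G (n + j) y - g y))" for n y
  have bdd: "bdd_above (range (\<lambda>j. norm (G (n + j) y - g y)))" for n y
    using d_bound by (intro bdd_aboveI2)
  have H_upper: "norm (G m y - g y) \<le> H n y" if "m \<ge> n" for m n y
    unfolding H_def using cSUP_upper[OF UNIV_I bdd[of n y], of "m - n"] that by simp
  have H_nonneg: "0 \<le> H n y" for n y
    using H_upper[of n n y] norm_ge_zero order_trans by blast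
  have H_le: "H n y \<le> c" if "\<And>m. m \<ge> n \<Longrightarrow> norm (G m y - g y) \<le> c" for n y c
    unfolding H_def by (rule cSUP_least) (use that in auto)
  have H_meas: "H n \<in> borel_measurable M" for n
    unfolding H_def by (intro borel_measurable_cSUP bdd) (use G g in auto)
  have H_lim: "(\<lambda>n. complex_of_real (H n y)) \<longlonglongrightarrow> 0" for y
  proof -
    have "(\<lambda>n. H n y) \<longlonglongrightarrow> 0"
    proof (rule LIMSEQ_I)
      fix e :: real assume "e > 0"
      then obtain n0 where "\<And>m. m \<ge> n0 \<Longrightarrow> norm (G m y - g y) < e / 2"
        using LIMSEQ_D[OF lim[of y], of "e / 2"] by auto
      then have "H n y \<le> e / 2" if "n \<ge> n0" for n
        using that by (intro H_le) (meson less_imp_le order_trans)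
      then show "\<exists>no. \<forall>n\<ge>no. norm (H n y - 0) < e"
        using \<open>e > 0\<close> H_nonneg by (intro exI[of _ n0]) (fastforce simp: abs_of_nonneg)
    qed
    then show ?thesis using tendsto_of_real[where 'a = complex] by fastforce
  qed
  have HB: "norm (complex_of_real (H n y)) \<le> 2 * B" for n y
    using H_nonneg d_bound by (auto intro!: H_le)
  have HL: "(\<lambda>y. complex_of_real (H n y)) \<in> Linf M" for n
    using HB by (intro LinfI[where B = "2 * B"]) (use H_meas in auto)
  let ?R = "\<lambda>n y. Re (rep (\<lambda>y. complex_of_real (H n y)) y)"
  have zeroL: "(\<lambda>_. 0) \<in> Linf M" by (rule LinfI[where B = 0]) auto
  have "rep (\<lambda>_. 0) x = 0" using rep_cmult[OF zeroL, of 0] by (metis mult_zero_left)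
  moreover have "(\<lambda>n. rep (\<lambda>y. complex_of_real (H n y)) x) \<longlonglongrightarrow> rep (\<lambda>_. 0) x"
    by (rule rep_tendsto[OF _ zeroL, where B = "2 * B"]) (use H_lim H_meas HB in auto)
  ultimately have R_lim: "(\<lambda>n. ?R n x) \<longlonglongrightarrow> 0"
    using tendsto_Re by fastforce
  have dom: "norm (rep (G m) y - rep g y) \<le> 2 * ?R n y" if "m \<ge> n" for m n y
  proof -
    have "norm (rep (\<lambda>y. G m y - g y) y) \<le> 2 * ?R n y"
      by (rule rep_dominated[OF Linf_diff[OF GL gL] HL H_upper[OF that]])
    then show ?thesis by (simp add: rep_diff GL gL)
  qed
  have "(\<lambda>n. rep (G n) (\<xi> n) - rep g (\<xi> n)) \<longlonglongrightarrow> 0"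
  proof (rule LIMSEQ_I)
    fix e :: real assume e: "e > 0"
    \<comment> \<open>The index \<open>m\<close> is fixed at the limit point \<open>x\<close>.
      Continuity of \<open>?R m\<close> carries the smallness to \<open>\<xi> n\<close> for large
      \<open>n\<close>, and \<open>dom\<close> then controls every later \<open>G n\<close>
      there.\<close>
    then obtain m where m: "?R m x < e / 2"
      using order_tendstoD(2)[OF R_lim, of "e / 2"] by (auto simp: eventually_sequentially)
    have "(\<lambda>n. ?R m (\<xi> n)) \<longlonglongrightarrow> ?R m x"
      by (intro tendsto_Re continuous_on_tendsto_compose[OF rep_representative(1)[OF HL] x]) auto
    then have "eventually (\<lambda>n. ?R m (\<xi> n) < e / 2) sequentially"
      using m by (rule order_tendstoD)
    moreover have "eventually (\<lambda>n. n \<ge> m) sequentially" by (rule eventually_ge_at_top)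
    ultimately have "eventually (\<lambda>n. norm (rep (G n) (\<xi> n) - rep g (\<xi> n)) < e) sequentially"
    proof eventually_elim
      case (elim n)
      then show ?case using dom[of m n "\<xi> n"] by linarith
    qed
    then show "\<exists>no. \<forall>n\<ge>no. norm (rep (G n) (\<xi> n) - rep g (\<xi> n) - 0) < e"
      by (simp add: eventually_sequentially)
  qed
  moreover have "(\<lambda>n. rep g (\<xi> n)) \<longlonglongrightarrow> rep g x"
    by (intro continuous_on_tendsto_compose[OF rep_representative(1)[OF gL] x]) auto
  ultimately show ?thesis
    using tendsto_add[of "\<lambda>n. rep (G n) (\<xi> n) - rep g (\<xi> n)" 0 sequentially "\<lambda>n. rep g (\<xi> n)" "rep g x"]
    by simp
qed

end

section \<open>Positive strong Feller semigroups\<close>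

locale feller_semigroup = full_support_measure M + sigma_finite_measure M
  for M :: "'a::polish_space measure" +
  fixes T :: "real \<Rightarrow> ('a \<Rightarrow> complex) \<Rightarrow> ('a \<Rightarrow> complex)"
  assumes star: "star_semigroup M T" and contractive: "contractive_semigroup M T"
    and positive_feller: "\<And>t. t > 0 \<Longrightarrow> positive_op M (T t) \<and> strong_feller M (T t)"
begin

lemma contraction: "t > 0 \<Longrightarrow> feller_contraction M (T t)"
  using contractive positive_feller full_support_measure_axioms
  by (simp add: feller_contraction_def feller_contraction_axioms_def contractive_semigroup_def)

abbreviation U :: "real \<Rightarrow> ('a \<Rightarrow> complex) \<Rightarrow> 'a \<Rightarrow> complex" where
  "U t f \<equiv> Cb_rep M (T t f)"

lemma rep_eq_U: "t > 0 \<Longrightarrow> feller_contraction.rep M (T t) = U t"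
  using feller_contraction.rep_def[OF contraction] by (simp add: fun_eq_iff)

lemma T_Linf: "t > 0 \<Longrightarrow> f \<in> Linf M \<Longrightarrow> T t f \<in> Linf M"
  using star by (auto simp: star_semigroup_def linear_op_def)

lemma U_continuous: "t > 0 \<Longrightarrow> f \<in> Linf M \<Longrightarrow> continuous_on UNIV (U t f)"
  using feller_contraction.rep_representative(1)[OF contraction] by (simp add: rep_eq_U)

lemma U_AE: "t > 0 \<Longrightarrow> f \<in> Linf M \<Longrightarrow> AE x in M. T t f x = U t f x"
  using feller_contraction.rep_representative(3)[OF contraction] by (simp add: rep_eq_U)

lemma U_Linf: "t > 0 \<Longrightarrow> f \<in> Linf M \<Longrightarrow> U t f \<in> Linf M"
  using feller_contraction.rep_Linf[OF contraction] by (simp add: rep_eq_U)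

lemma U_bound:
  assumes "t > 0" "f \<in> Linf M" "B > 0" "AE x in M. norm (f x) \<le> B"
  shows "norm (U t f x) \<le> B"
  using feller_contraction.rep_bound[OF contraction[OF assms(1)] Linf_measurable[OF assms(2)] assms(3,4)]
  by (simp add: rep_eq_U assms(1))

text \<open>Both sides are continuous, so almost everywhere equality suffices. Replacing
  \<open>T s f\<close> by \<open>U s f\<close> under \<open>T t\<close> is allowed since operators
  respect almost everywhere equality.\<close>

lemma U_semigroup:
  assumes t: "t > 0" and s: "s > 0" and f: "f \<in> Linf M"
  shows "U (t + s) f = U t (U s f)"
proof -
  interpret K: feller_contraction M "T t" using t by (rule contraction)
  interpret Kts: feller_contraction M "T (t + s)" using t s by (intro contraction) simp
  have TsL: "T s f \<in> Linf M" by (rule T_Linf[OF s f])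
  have "Kts.rep f = U t (U s f)"
  proof (rule Kts.rep_eqI[OF f])
    show "continuous_on UNIV (U t (U s f))" by (intro U_continuous U_Linf t s f)
    have "AE x in M. T (t + s) f x = T t (T s f) x"
      using star t s f by (auto simp: star_semigroup_def)
    moreover have "AE x in M. T t (T s f) x = U t (T s f) x"
      by (rule U_AE[OF t TsL])
    moreover have "U t (T s f) = U t (U s f)"
      using K.rep_cong[OF TsL U_Linf[OF s f] U_AE[OF s f]] by (simp add: rep_eq_U t)
    ultimately show "AE x in M. T (t + s) f x = U t (U s f) x"
      by auto
  qed
  then show ?thesis using t s by (simp add: rep_eq_U)
qed

text \<open>Weak\<open>*\<close> measurability becomes pointwise measurability because \<open>U s f x\<close> is a limit of averages
  of \<open>T s f\<close> over shrinking balls around \<open>x\<close>.\<close>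

lemma U_measurable:
  assumes f: "f \<in> Linf M"
  shows "(\<lambda>s. if s \<in> {0<..} then U s f x else 0) \<in> borel_measurable lebesgue"
proof (rule borel_measurable_if_I)
  \<comment> \<open>Balls may have infinite measure. Sigma-finiteness provides a positive integrable
    weight, and the averages are taken with respect to it.\<close>
  obtain w :: "'a \<Rightarrow> real" where w[measurable]: "w \<in> borel_measurable M" and w_pos: "\<And>x. w x > 0"
    and w_int: "integrable M w"
    by (rule obtain_positive_integrable_function) blast
  define A where "A n = ball x (inverse (real (Suc n)))" for n
  have A[measurable]: "A n \<in> sets M" for n by (simp add: A_def sets_M)
  define g where "g n y = indicator (A n) y * w y" for n y
  have g_int: "integrable M (g n)" for n
    unfolding g_def using w_int A by (intro integrable_mult_indicator[where 'b = real, simplified]) auto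
  define c where "c n = (LINT y|M. g n y)" for n
  have g_nonneg: "g n y \<ge> 0" for n y
    using w_pos[of y] by (simp add: g_def indicator_def)
  \<comment> \<open>A vanishing integral would make the ball \<open>A n\<close> null, against full
    support.\<close>
  have c_pos: "c n > 0" for n
  proof -
    have "c n \<noteq> 0"
    proof
      assume "c n = 0"
      then have "AE y in M. g n y = 0"
        unfolding c_def using integral_nonneg_eq_0_iff_AE[OF g_int] g_nonneg by auto
      then have "AE y in M. y \<notin> A n"
      proof eventually_elim
        case (elim y)
        then show ?case using w_pos[of y] by (auto simp: g_def)
      qed
      then have "emeasure M (A n) = 0"
        by (subst (asm) AE_iff_measurable[of "A n"]) auto
      then show False
        using full unfolding full_support_def A_def
        by (metis inverse_positive_iff_positive less_irrefl of_nat_0_less_iff zero_less_Suc)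
    qed
    moreover have "c n \<ge> 0" unfolding c_def using g_nonneg by (intro integral_nonneg_AE) auto
    ultimately show ?thesis by simp
  qed
  show "(\<lambda>s. U s f x) \<in> borel_measurable (lebesgue_on {0<..})"
  proof (rule borel_measurable_LIMSEQ_metric)
    fix n
    have "(\<lambda>y. complex_of_real (g n y)) \<in> L1 M"
      using g_int by (simp add: L1_def)
    then have "(\<lambda>s. pairing M (T s f) (\<lambda>y. complex_of_real (g n y))) \<in> borel_measurable (lebesgue_on {0<..})"
      using star f by (auto simp: star_semigroup_def)
    then show "(\<lambda>s. pairing M (T s f) (\<lambda>y. complex_of_real (g n y)) / of_real (c n))
        \<in> borel_measurable (lebesgue_on {0<..})" by measurable
  next
    fix s assume "s \<in> space (lebesgue_on {0::real<..})"
    then have s: "s > 0" by simp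
    show "(\<lambda>n. pairing M (T s f) (\<lambda>y. complex_of_real (g n y)) / of_real (c n)) \<longlonglongrightarrow> U s f x"
    proof (rule LIMSEQ_I)
      fix e :: real assume e: "e > 0"
      obtain \<delta> where \<delta>: "\<delta> > 0" "\<And>y. dist y x < \<delta> \<Longrightarrow> dist (U s f y) (U s f x) < e / 2"
        using U_continuous[OF s f] e unfolding continuous_on_iff by (meson UNIV_I half_gt_zero)
      obtain n0 where n0: "inverse (real (Suc n0)) < \<delta>" using reals_Archimedean \<delta>(1) by blast
      have "norm (pairing M (T s f) (\<lambda>y. complex_of_real (g n y)) / of_real (c n) - U s f x) < e"
        if "n \<ge> n0" for n
      proof -
        have near: "dist (U s f y) (U s f x) < e / 2" if "y \<in> A n" for y
        proof -
          have "inverse (real (Suc n)) \<le> inverse (real (Suc n0))"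
            using \<open>n \<ge> n0\<close> by (simp add: field_simps)
          moreover have "dist x y < inverse (real (Suc n))"
            using that by (simp only: A_def mem_ball)
          ultimately have "dist y x < \<delta>"
            using n0 unfolding dist_commute[of y x] by linarith
          then show ?thesis by (rule \<delta>(2))
        qed
        have [measurable]: "U s f \<in> borel_measurable M" "T s f \<in> borel_measurable M"
          by (rule Linf_measurable[OF U_Linf[OF s f]], rule Linf_measurable[OF T_Linf[OF s f]])
        have [measurable]: "g n \<in> borel_measurable M" using g_int by (rule borel_measurable_integrable)
        obtain B where B: "\<And>y. norm (U s f y) \<le> B"
          using LinfE[OF f] U_bound[OF s f] by metis
        have i1: "integrable M (\<lambda>y. U s f y * complex_of_real (g n y))"
        proof (rule Bochner_Integration.integrable_bound[OF integrable_mult_right[OF g_int, of B]])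
          show "AE y in M. norm (U s f y * complex_of_real (g n y)) \<le> norm (B * g n y)"
          proof (rule AE_I2)
            fix y
            have "norm (U s f y) * g n y \<le> B * g n y"
              using B g_nonneg by (rule mult_right_mono)
            then show "norm (U s f y * complex_of_real (g n y)) \<le> norm (B * g n y)"
              using g_nonneg[of n y] by (simp add: norm_mult)
          qed
        qed measurable
        have i2: "integrable M (\<lambda>y. U s f x * complex_of_real (g n y))"
          using g_int by simp
        have "pairing M (T s f) (\<lambda>y. complex_of_real (g n y)) = (LINT y|M. U s f y * complex_of_real (g n y))"
          unfolding pairing_def
        proof (rule integral_cong_AE)
          show "AE y in M. T s f y * complex_of_real (g n y) = U s f y * complex_of_real (g n y)"
            using U_AE[OF s f] by eventually_elim simp
        qed measurable
        moreover have "U s f x * of_real (c n) = (LINT y|M. U s f x * complex_of_real (g n y))"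
          by (simp add: c_def)
        \<comment> \<open>Since \<open>g n\<close> has total mass \<open>c n\<close>, subtracting
          \<open>U s f x\<close> under the integral leaves an integrand supported in
          \<open>A n\<close>, where the oscillation is below \<open>e / 2\<close>.\<close>
        ultimately have "pairing M (T s f) (\<lambda>y. complex_of_real (g n y)) - U s f x * of_real (c n)
            = (LINT y|M. (U s f y - U s f x) * complex_of_real (g n y))"
          using i1 i2 by (simp add: left_diff_distrib)
        also have "norm \<dots> \<le> (LINT y|M. e / 2 * g n y)"
        proof (rule order_trans[OF integral_norm_bound integral_mono'])
          show "integrable M (\<lambda>y. e / 2 * g n y)" using g_int by simp
          show "norm ((U s f y - U s f x) * complex_of_real (g n y)) \<le> e / 2 * g n y" for y
          proof (cases "y \<in> A n")
            case True
            have "norm (U s f y - U s f x) * g n y \<le> e / 2 * g n y"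
              using near[OF True] g_nonneg by (intro mult_right_mono) (auto simp: dist_norm)
            then show ?thesis
              using g_nonneg[of n y] by (simp only: norm_mult norm_of_real abs_of_nonneg)
          next
            case False
            then show ?thesis by (simp add: g_def)
          qed
          show "0 \<le> e / 2 * g n y" for y using e g_nonneg[of n y] by simp
        qed
        also have "\<dots> = e / 2 * c n" by (simp add: c_def)
        finally have *: "norm (pairing M (T s f) (\<lambda>y. complex_of_real (g n y)) - U s f x * of_real (c n))
            \<le> e / 2 * c n" .
        have "pairing M (T s f) (\<lambda>y. complex_of_real (g n y)) / of_real (c n) - U s f x
          = (pairing M (T s f) (\<lambda>y. complex_of_real (g n y)) - U s f x * of_real (c n)) / of_real (c n)"
          using c_pos[of n] by (simp add: field_simps)
        then have "norm (pairing M (T s f) (\<lambda>y. complex_of_real (g n y)) / of_real (c n) - U s f x)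
          = norm (pairing M (T s f) (\<lambda>y. complex_of_real (g n y)) - U s f x * of_real (c n)) / c n"
          using c_pos[of n] by (simp add: norm_divide)
        also have "\<dots> \<le> e / 2" using * c_pos[of n] by (simp add: divide_le_eq)
        finally show ?thesis using e by simp
      qed
      then show "\<exists>no. \<forall>n\<ge>no. norm (pairing M (T s f) (\<lambda>y. complex_of_real (g n y)) / of_real (c n)
          - U s f x) < e" by blast
    qed
  qed
qed simp

section \<open>Pointwise continuity in time\<close>

text \<open>Convergence in mean on a product of time and space yields almost everywhere convergence
  along a subsequence. Fubini selects one time \<open>s < t\<close> that is good for almost every
  point, and \<open>T (t - s)\<close> removes the exceptional null set.\<close>

lemma U_subsequence:
  assumes f: "f \<in> Linf M" and t: "t > 0" and \<tau>: "\<tau> \<longlonglongrightarrow> t"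
  shows "\<exists>r :: nat \<Rightarrow> nat. strict_mono r \<and> (\<forall>x. (\<lambda>n. U (\<tau> (r n)) f x) \<longlonglongrightarrow> U t f x)"
proof -
  obtain B where B: "B > 0" "AE x in M. norm (f x) \<le> B" using LinfE[OF f] by metis
  define h where "h n = \<tau> n - t" for n
  have h: "h \<longlonglongrightarrow> 0" unfolding h_def using \<tau> by (simp add: LIM_zero)
  \<comment> \<open>Extension by zero keeps the orbit defined, bounded and continuous in
    \<open>x\<close> when a shifted time \<open>s + h n\<close> is not positive.\<close>
  define v where "v s x = (if s \<in> {0<..} then U s f x else 0)" for s x
  have v_bound: "norm (v s x) \<le> B" for s x
    using U_bound[OF _ f B] B(1) by (simp add: v_def)
  have v_diff_bound: "norm (v s x - v s' x) \<le> 2 * B" for s s' x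
    using norm_triangle_ineq4[of "v s x" "v s' x"] v_bound[of s x] v_bound[of s' x] by linarith
  have v_meas: "(\<lambda>s. v s x) \<in> borel_measurable lebesgue" for x
    unfolding v_def by (rule U_measurable[OF f])
  have v_cont: "continuous_on UNIV (v s)" for s
    using U_continuous[OF _ f, of s] by (cases "s > 0") (simp_all add: v_def)
  obtain w :: "'a \<Rightarrow> real" where w[measurable]: "w \<in> borel_measurable M" and w_pos: "\<And>x. w x > 0"
    and w_int: "integrable M w"
    by (rule obtain_positive_integrable_function) blast
  \<comment> \<open>A finite measure with the same null sets as \<open>M\<close>, because the
    density is strictly positive.\<close>
  define P where "P = density M (\<lambda>x. ennreal (w x))"
  \<comment> \<open>Any interval of positive length inside the open interval from 0 to
    \<open>t\<close> would do: both \<open>s\<close> and \<open>t - s\<close> must be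
    positive.\<close>
  define L where "L = lebesgue_on {t/4..t/2}"
  have sets_P: "sets P = sets borel" by (simp add: P_def sets_M)
  interpret P: finite_measure P
  proof
    have "emeasure P (space P) = (\<integral>\<^sup>+x. ennreal (w x) \<partial>M)"
      unfolding P_def by (subst emeasure_density) (auto simp: sets_M intro!: nn_integral_cong)
    also have "\<dots> = ennreal (LINT x|M. w x)"
      by (rule nn_integral_eq_integral[OF w_int]) (use w_pos less_imp_le in blast)
    finally show "emeasure P (space P) \<noteq> \<infinity>" by simp
  qed
  interpret L: finite_measure L
    unfolding L_def by (intro finite_measure_lebesgue_on) auto
  interpret LP: pair_sigma_finite L P ..
  interpret LP': finite_measure "L \<Otimes>\<^sub>M P"
    by (rule finite_measure_pair_measure) unfold_locales
  define d where "d n = (\<lambda>(s, x). v (s + h n) x - v s x)" for n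
  have shift_meas: "(\<lambda>(s, x). v (s + k) x) \<in> borel_measurable (L \<Otimes>\<^sub>M P)" for k
  proof -
    have "(\<lambda>(s, x). v (s + k) x) \<in> borel_measurable (L \<Otimes>\<^sub>M borel)"
    proof (rule caratheodory_measurable)
      show "(\<lambda>s. v (s + k) x) \<in> borel_measurable L" for x
        unfolding L_def by (intro measurable_restrict_space1 lebesgue_measurable_shift v_meas)
    qed (rule v_cont)
    moreover have "sets (L \<Otimes>\<^sub>M P) = sets (L \<Otimes>\<^sub>M borel)"
      by (rule sets_pair_measure_cong[OF refl sets_P])
    ultimately show ?thesis using measurable_cong_sets by blast
  qed
  have d_meas[measurable]: "d n \<in> borel_measurable (L \<Otimes>\<^sub>M P)" for n
  proof -
    have "(\<lambda>p. (case p of (s, x) \<Rightarrow> v (s + h n) x) - (case p of (s, x) \<Rightarrow> v (s + 0) x))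
        \<in> borel_measurable (L \<Otimes>\<^sub>M P)"
      by (intro borel_measurable_diff shift_meas)
    then show ?thesis by (simp add: d_def case_prod_beta')
  qed
  have d_bound: "norm (d n p) \<le> 2 * B" for n p
    using v_diff_bound by (simp add: d_def split: prod.split)
  have d_int: "integrable (L \<Otimes>\<^sub>M P) (d n)" for n
    by (rule LP'.integrable_const_bound[where B = "2 * B"]) (use d_bound in auto)
  have "(\<lambda>n. LINT p|(L \<Otimes>\<^sub>M P). norm (d n p)) \<longlonglongrightarrow> 0"
  proof -
    have int_norm: "integrable (L \<Otimes>\<^sub>M P) (\<lambda>(s, x). norm (d n (s, x)))" for n
      using integrable_norm[OF d_int] by (simp add: case_prod_beta')
    \<comment> \<open>With the time integral inside, \<open>x\<close> is fixed and the translation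
      lemma applies to its single orbit. Dominated convergence handles the outer integral.\<close>
    have eq: "(LINT p|(L \<Otimes>\<^sub>M P). norm (d n p)) = (LINT x|P. (LINT s|L. norm (d n (s, x))))" for n
      using LP.integral_snd[OF int_norm[of n]] by (simp add: case_prod_beta')
    have "(\<lambda>n. LINT x|P. (LINT s|L. norm (d n (s, x)))) \<longlonglongrightarrow> (LINT x|P. 0)"
    proof (rule integral_dominated_convergence[where w = "\<lambda>_. 2 * B * measure L (space L)"])
      show "(\<lambda>x. LINT s|L. norm (d n (s, x))) \<in> borel_measurable P" for n
        using LP.integrable_snd[OF int_norm[of n]] by (rule borel_measurable_integrable)
      have "(\<lambda>n. LINT s|L. norm (d n (s, x))) \<longlonglongrightarrow> 0" for x
        unfolding d_def L_def using shift_integral_tendsto[OF v_meas v_bound h] by simp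
      then show "AE x in P. (\<lambda>n. LINT s|L. norm (d n (s, x))) \<longlonglongrightarrow> 0" by simp
      have "(LINT s|L. norm (d n (s, x))) \<le> (LINT s|L. 2 * B)" for n x
        using B(1) d_bound by (intro integral_mono') auto
      then show "AE x in P. norm (LINT s|L. norm (d n (s, x))) \<le> 2 * B * measure L (space L)" for n
        by (simp add: mult_ac)
    qed auto
    then show ?thesis by (simp add: eq)
  qed
  from tendsto_L1_AE_subseq[OF d_int this] obtain r :: "nat \<Rightarrow> nat" where r: "strict_mono r"
    and ae: "AE p in L \<Otimes>\<^sub>M P. (\<lambda>n. d (r n) p) \<longlonglongrightarrow> 0" by blast
  have "AE s in L. AE x in P. (\<lambda>n. d (r n) (s, x)) \<longlonglongrightarrow> 0"
    using LP.AE_pair[OF ae] .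
  then have "AE s in L. s \<in> space L \<and> (AE x in P. (\<lambda>n. d (r n) (s, x)) \<longlonglongrightarrow> 0)"
    by (auto intro: AE_space)
  \<comment> \<open>Positive length of the interval turns a property of almost every
    \<open>s\<close> into the existence of one.\<close>
  moreover have "ae_filter L \<noteq> bot"
    using t by (simp add: ae_filter_eq_bot_iff L_def emeasure_restrict_space space_restrict_space)
  ultimately obtain s where s: "s \<in> space L" "AE x in P. (\<lambda>n. d (r n) (s, x)) \<longlonglongrightarrow> 0"
    using eventually_happens' by blast
  have st: "s > 0" "s < t" using s(1) t by (auto simp: L_def)
  have "AE x in M. (\<lambda>n. d (r n) (s, x)) \<longlonglongrightarrow> 0"
    using s(2) w_pos unfolding P_def by (subst (asm) AE_density) auto
  then have ae': "AE x in M. (\<lambda>n. v (s + h (r n)) x) \<longlonglongrightarrow> U s f x"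
  proof eventually_elim
    case (elim x)
    then show ?case using st(1) by (simp add: d_def LIM_zero_iff v_def)
  qed
  interpret K: feller_contraction M "T (t - s)" using st by (intro contraction) simp
  have "(\<lambda>n. K.rep (v (s + h (r n))) x) \<longlonglongrightarrow> K.rep (U s f) x" for x
    by (rule K.rep_tendsto[OF _ _ _ ae', where B = B])
      (auto intro!: continuous_measurable v_cont v_bound U_Linf st f)
  moreover have "K.rep = U (t - s)" using st by (intro rep_eq_U) simp
  moreover have "U (t - s) (U s f) = U t f"
    using U_semigroup[of "t - s" s f] st f by simp
  ultimately have lim: "(\<lambda>n. U (t - s) (v (s + h (r n))) x) \<longlonglongrightarrow> U t f x" for x
    by simp
  have "eventually (\<lambda>n. s + h (r n) > 0) sequentially"
  proof -
    have "(\<lambda>n. s + h (r n)) \<longlonglongrightarrow> s + 0"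
      using LIMSEQ_subseq_LIMSEQ[OF h r] by (intro tendsto_add tendsto_const) (simp add: o_def)
    then show ?thesis using st(1) by (intro order_tendstoD(1)) auto
  qed
  \<comment> \<open>Once the shifted time is positive, the semigroup law gives
    \<open>(t - s) + (s + h (r n)) = \<tau> (r n)\<close>.\<close>
  then have "eventually (\<lambda>n. U (t - s) (v (s + h (r n))) = U (\<tau> (r n)) f) sequentially"
  proof eventually_elim
    case (elim n)
    then have "v (s + h (r n)) = U (s + h (r n)) f" by (auto simp: v_def)
    then show ?case
      using U_semigroup[of "t - s" "s + h (r n)" f] elim st f by (simp add: h_def)
  qed
  then have "(\<lambda>n. U (\<tau> (r n)) f x) \<longlonglongrightarrow> U t f x" for x
    by (rule Lim_transform_eventually[OF lim, OF eventually_mono]) simp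
  with r show ?thesis by blast
qed

text \<open>Subsequence principle: a subsequence staying at distance \<open>e\<close> from the limit
  would itself have a further subsequence converging to it.\<close>

lemma U_tendsto:
  assumes f: "f \<in> Linf M" and t: "t > 0" and \<tau>: "\<tau> \<longlonglongrightarrow> t"
  shows "(\<lambda>n. U (\<tau> n) f x) \<longlonglongrightarrow> U t f x"
proof (rule ccontr)
  assume "\<not> ?thesis"
  then obtain e where e: "e > 0" "\<And>N. \<exists>n\<ge>N. \<not> dist (U (\<tau> n) f x) (U t f x) < e"
    unfolding lim_sequentially by blast
  then have "infinite {n. \<not> dist (U (\<tau> n) f x) (U t f x) < e}"
    by (auto simp: infinite_nat_iff_unbounded_le)
  then obtain q :: "nat \<Rightarrow> nat" where q: "strict_mono q" "\<And>n. \<not> dist (U (\<tau> (q n)) f x) (U t f x) < e"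
    by (metis (mono_tags, lifting) infinite_enumerate mem_Collect_eq)
  have "(\<lambda>n. \<tau> (q n)) \<longlonglongrightarrow> t" using LIMSEQ_subseq_LIMSEQ[OF \<tau> q(1)] by (simp add: o_def)
  from U_subsequence[OF f t this] obtain r :: "nat \<Rightarrow> nat"
    where "(\<lambda>n. U (\<tau> (q (r n))) f x) \<longlonglongrightarrow> U t f x" by blast
  then show False using e(1) q(2) unfolding lim_sequentially by blast
qed

section \<open>Joint continuity and uniformity on compact sets\<close>

text \<open>Half of the time is held back. The orbit at times near \<open>t / 2\<close> converges
  pointwise, and the fixed operator \<open>T (t / 2)\<close> turns this into convergence along
  moving points.\<close>

lemma U_continuous_convergence:
  assumes f: "f \<in> Linf M" and t: "t > 0" and \<tau>: "\<tau> \<longlonglongrightarrow> t" and \<xi>: "\<xi> \<longlonglongrightarrow> x"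
  shows "(\<lambda>n. U (\<tau> n) f (\<xi> n)) \<longlonglongrightarrow> U t f x"
proof -
  obtain B where B: "B > 0" "AE x in M. norm (f x) \<le> B" using LinfE[OF f] by metis
  \<comment> \<open>The intended time is \<open>\<tau> n - t / 2\<close>, which tends to
    \<open>t / 2\<close>. The floor \<open>t / 4\<close> keeps it positive for every
    \<open>n\<close> and is inactive once \<open>\<tau> n > 3 / 4 * t\<close>.\<close>
  define \<sigma> where "\<sigma> n = max (t / 4) (\<tau> n - t / 2)" for n
  have \<sigma>_pos: "\<sigma> n > 0" for n using t by (simp add: \<sigma>_def)
  have "\<sigma> \<longlonglongrightarrow> max (t / 4) (t - t / 2)"
    unfolding \<sigma>_def by (intro tendsto_intros \<tau>)
  moreover have "max (t / 4) (t - t / 2) = t / 2" using t by simp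
  ultimately have \<sigma>: "\<sigma> \<longlonglongrightarrow> t / 2" by simp
  have t2: "t / 2 > 0" using t by simp
  interpret K: feller_contraction M "T (t / 2)" using t2 by (rule contraction)
  have "(\<lambda>n. K.rep (U (\<sigma> n) f) (\<xi> n)) \<longlonglongrightarrow> K.rep (U (t / 2) f) x"
    by (rule K.rep_continuous_convergence[where B = B])
      (auto intro!: Linf_measurable U_Linf U_bound U_tendsto \<sigma>_pos t2 f B \<sigma> \<xi>)
  then have lim: "(\<lambda>n. U (t / 2 + \<sigma> n) f (\<xi> n)) \<longlonglongrightarrow> U t f x"
    using U_semigroup[OF t2 \<sigma>_pos f] U_semigroup[OF t2 t2 f] by (simp add: rep_eq_U[OF t2])
  have "eventually (\<lambda>n. \<tau> n > 3 / 4 * t) sequentially"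
    using \<tau> t by (intro order_tendstoD) auto
  then have "eventually (\<lambda>n. U (t / 2 + \<sigma> n) f (\<xi> n) = U (\<tau> n) f (\<xi> n)) sequentially"
    by eventually_elim (simp add: \<sigma>_def max_def)
  from Lim_transform_eventually[OF lim this] show ?thesis .
qed

lemma U_jointly_continuous:
  assumes f: "f \<in> Linf M"
  shows "continuous_on ({0<..} \<times> UNIV) (\<lambda>(t, x). U t f x)"
proof (rule continuous_on_sequentiallyI)
  fix p :: "nat \<Rightarrow> real \<times> 'a" and a assume a: "a \<in> {0<..} \<times> UNIV" and lim: "p \<longlonglongrightarrow> a"
  have "(\<lambda>n. U (fst (p n)) f (snd (p n))) \<longlonglongrightarrow> U (fst a) f (snd a)"
    by (rule U_continuous_convergence[OF f _ tendsto_fst[OF lim] tendsto_snd[OF lim]]) (use a in auto)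
  then show "(\<lambda>n. case p n of (t, x) \<Rightarrow> U t f x) \<longlonglongrightarrow> (case a of (t, x) \<Rightarrow> U t f x)"
    by (simp add: case_prod_beta')
qed

text \<open>Joint continuity and compactness of \<open>C\<close> give one neighbourhood of
  \<open>t\<close> that serves all points of \<open>C\<close> at once.\<close>

lemma U_uniform_limit:
  assumes f: "f \<in> Linf M" and t: "t > 0" and \<tau>: "\<tau> \<longlonglongrightarrow> t" and \<tau>_pos: "\<And>n. \<tau> n > 0"
    and C: "compact C"
  shows "uniform_limit C (\<lambda>n. U (\<tau> n) f) (U t f) sequentially"
proof (rule uniform_limitI)
  fix e :: real assume e: "e > 0"
  have cont: "continuous_on ({0<..} \<times> C) (\<lambda>(t, x). U t f x)"
    by (rule continuous_on_subset[OF U_jointly_continuous[OF f]]) auto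
  obtain X where X: "t \<in> X" "open X" "\<forall>s\<in>X \<inter> {0<..}. \<forall>x\<in>C. dist (U s f x) (U t f x) \<le> e / 2"
    using continuous_on_prod_compactE[OF cont C, of t "e / 2"] t e by auto
  have "eventually (\<lambda>n. \<tau> n \<in> X) sequentially"
    using topological_tendstoD[OF \<tau> X(2,1)] .
  then show "eventually (\<lambda>n. \<forall>x\<in>C. dist (U (\<tau> n) f x) (U t f x) < e) sequentially"
  proof eventually_elim
    case (elim n)
    then have "\<forall>x\<in>C. dist (U (\<tau> n) f x) (U t f x) \<le> e / 2" using X(3) \<tau>_pos by auto
    then show ?case using e by fastforce
  qed
qed

end

theorem theorem3p7:
  fixes M :: "'a::polish_space measure"
    and T :: "real \<Rightarrow> ('a \<Rightarrow> complex) \<Rightarrow> ('a \<Rightarrow> complex)"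
    and A :: "(('a \<Rightarrow> complex) \<times> ('a \<Rightarrow> complex)) set"
  assumes "sets M = sets borel" and "sigma_finite_measure M" and "full_support M"
    and "star_semigroup M T" and "injective_semigroup M T" and "contractive_semigroup M T"
    and "is_generator M T A"
    and "\<And>t. t > 0 \<Longrightarrow> positive_op M (T t) \<and> strong_feller M (T t)"
  shows "(\<forall>\<tau> t f. (\<forall>n::nat. \<tau> n > 0) \<and> \<tau> \<longlonglongrightarrow> t \<and> t > 0 \<and> f \<in> Linf M \<longrightarrow>
            (\<forall>C. compact C \<longrightarrow>
               uniform_limit C (\<lambda>n. Cb_rep M (T (\<tau> n) f)) (Cb_rep M (T t f)) sequentially))
       \<and> (\<forall>f\<in>Linf M. continuous_on ({0<..} \<times> UNIV) (\<lambda>(t, x). Cb_rep M (T t f) x))"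
proof -
  interpret feller_semigroup M T
    by (intro feller_semigroup.intro full_support_measure.intro feller_semigroup_axioms.intro assms)
  show ?thesis using U_uniform_limit U_jointly_continuous by blast
qed

end
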